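(* Let $\mathcal{P}$ be a partition of the scenario set $S$ and let $\underline{x}$ be an optimal solution of the partitioned model $\mathrm{L}(\mathcal{P})$. If $\underline{x}$ is the unique optimal solution of $\mathrm{L}(\mathcal{P})$ and $\underline{x}$ is infeasible for the original problem, then any refinement $\mathcal{R}$ of $\mathcal{P}$ created by applying the Minimal Size Refinement algorithm to $(S,\mathcal{P},\underline{x})$ is a smallest-size refinement of $\mathcal{P}$ such that $$v^{L}(\mathcal{R}) > v^{L}(\mathcal{P}).$$ That is, $v^{L}(\mathcal{R})>v^{L}(\mathcal{P})$, and every refinement $\mathcal{R}'$ of $\mathcal{P}$ with $v^{L}(\mathcal{R}')>v^{L}(\mathcal{P})$ satisfies $|\mathcal{R}'|\ge|\mathcal{R}|$.
   Context: Setting. $S$ is a finite nonempty set of scenarios, $\tau\in[0,1]$, $\mathcal{X}\subseteq\mathbb{R}^n$, $f:\mathcal{X}\to\mathbb{R}$, and for each $s\in S$ a set $X^s\subseteq\mathbb{R}^n$ is given. All scenarios are equiprobable: $p_s=1/|S|$ for all $s\in S$. Original problem: $v^*=\min\{f(x): x\in\mathcal{X},\ \sum_{s\in S}p_s\mathbf{1}(x\in X^s)\ge 1-\tau\}$. A point $x\in\mathcal X$ is feasible (infeasible) for it if the inequality holds (fails). A partition $\mathcal{P}$ of $S$ is a collection of non-empty, pairwise disjoint subsets of $S$ whose union is $S$. For $P\subseteq S$ put $X^P=\bigcap_{s\in P}X^s$, and for $x\in\mathcal X$ put $z_P(x)=\mathbf{1}(x\in X^P)$. Partitioned model $\mathrm{L}(\mathcal{P})$: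 $v^{L}(\mathcal{P})=\min\{f(x): x\in\mathcal{X},\ \sum_{P\in\mathcal{P}}q_P z_P(x)\ge\sum_{P\in\mathcal{P}}q_P-\tau\}$ with $q_P=\min_{s\in P}p_s$. Under equiprobability the constraint is equivalent to $\sum_{P\in\mathcal{P}}z_P(x)\ge|\mathcal{P}|-\lfloor\tau|S|\rfloor$. A minimization problem is assumed to attain its minimum whenever it is feasible, and has value $+\infty$ if it is infeasible. A partition $\mathcal{R}$ of $S$ is a refinement of $\mathcal{P}$ if for every $R\in\mathcal{R}$ there is $P\in\mathcal{P}$ with $R\subseteq P$. For $x\in\mathcal{X}$ and a partition $\mathcal A$ of $S$: $\mathcal{A}_I(x)=\{A\in\mathcal{A}: x\notin X^A\}$ and $S_I(x)=\{s\in S: x\notin X^s\}$. Minimal Size Refinement algorithm. Input: $S$, a partition $\mathcal{P}$ of $S$, a point $\underline{x}\in\mathcal{X}$. Initialize $\mathcal{R}\leftarrow\mathcal{P}$ and $\mu\leftarrow\lfloor\tau|S|\rfloor+1-|\mathcal{P}_I(\underline{x})|$. While $|\mathcal{R}|<|\mathcal{P}|+\mu$: select $R_1\in\mathcal{R}_I(\underline{x})$ with $|R_1\cap S_I(\underline{x})|\ge2$; select two distinct scenarios $s_1,s_2\in R_1\cap S_I(\underline{x})$; set $R_{\text{left}}=\{s_1\}$, $R_{\text{right}}=\{s_2\}$; allocate each remaining scenario of $R_1\setminus\{s_1,s_2\}$ to exactly one of $R_{\text{left}}$, $R_{\text{right}}$ (arbitrarily); replace $R_1$ in $\mathcal{R}$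 by the two sets $R_{\text{left}},R_{\text{right}}$. Return $\mathcal{R}$. (All selections are arbitrary.) *)

theory Defs
  imports "HOL-Analysis.Analysis"
begin

text \<open>
  Chance-constrained minimisation of \<open>f\<close> over \<open>\<X>\<close> with finitely many scenarios \<open>s \<in> S\<close>,
  probabilities \<open>p s\<close>, scenario sets \<open>X s\<close> and risk level \<open>\<tau>\<close>.
\<close>

definition original_feasible ::
  "'s set \<Rightarrow> ('s \<Rightarrow> real) \<Rightarrow> real \<Rightarrow> 'x set \<Rightarrow> ('s \<Rightarrow> 'x set) \<Rightarrow> 'x set" where
  "original_feasible S p \<tau> \<X> X =
     {x \<in> \<X>. (\<Sum>s\<in>S. p s * indicat_real (X s) x) \<ge> 1 - \<tau>}"

definition block_set :: "('s \<Rightarrow> 'x set) \<Rightarrow> 's set \<Rightarrow> 'x set" where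
  "block_set X P = (\<Inter>s\<in>P. X s)"

definition block_weight :: "('s \<Rightarrow> real) \<Rightarrow> 's set \<Rightarrow> real" where
  "block_weight p P = Min (p ` P)"

definition L_feasible ::
  "('s \<Rightarrow> real) \<Rightarrow> real \<Rightarrow> 'x set \<Rightarrow> ('s \<Rightarrow> 'x set) \<Rightarrow> 's set set \<Rightarrow> 'x set" where
  "L_feasible p \<tau> \<X> X \<P> =
     {x \<in> \<X>. (\<Sum>P\<in>\<P>. block_weight p P * indicat_real (block_set X P) x)
              \<ge> (\<Sum>P\<in>\<P>. block_weight p P) - \<tau>}"

definition L_optimal ::
  "('s \<Rightarrow> real) \<Rightarrow> real \<Rightarrow> 'x set \<Rightarrow> ('x \<Rightarrow> real) \<Rightarrow> ('s \<Rightarrow> 'x set) \<Rightarrow> 's set set \<Rightarrow> 'x \<Rightarrow> bool" where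
  "L_optimal p \<tau> \<X> f X \<P> x \<longleftrightarrow> is_arg_min f (\<lambda>y. y \<in> L_feasible p \<tau> \<X> X \<P>) x"

text \<open>
  The infimum in \<open>ereal\<close> is \<open>\<infinity>\<close> when the model is infeasible, and the minimum whenever one is attained.
\<close>

definition L_value ::
  "('s \<Rightarrow> real) \<Rightarrow> real \<Rightarrow> 'x set \<Rightarrow> ('x \<Rightarrow> real) \<Rightarrow> ('s \<Rightarrow> 'x set) \<Rightarrow> 's set set \<Rightarrow> ereal" where
  "L_value p \<tau> \<X> f X \<P> = (INF x\<in>L_feasible p \<tau> \<X> X \<P>. ereal (f x))"

definition infeasible_blocks :: "('s \<Rightarrow> 'x set) \<Rightarrow> 's set set \<Rightarrow> 'x \<Rightarrow> 's set set" where
  "infeasible_blocks X \<A> x = {A \<in> \<A>. x \<notin> block_set X A}"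

definition infeasible_scenarios :: "('s \<Rightarrow> 'x set) \<Rightarrow> 's set \<Rightarrow> 'x \<Rightarrow> 's set" where
  "infeasible_scenarios X S x = {s \<in> S. x \<notin> X s}"

text \<open>
  Minimal Size Refinement is nondeterministic, hence modelled by relations: \<open>msr_step\<close> is one
  execution of the loop body, \<open>msr_loop\<close> runs it while the size is below \<open>N\<close>, and
  \<open>msr_returns S \<tau> X \<P> x \<R>\<close> says that \<open>\<R>\<close> is a possible output for the input \<open>(S, \<P>, x)\<close>.
\<close>

inductive msr_step ::
  "'s set \<Rightarrow> ('s \<Rightarrow> 'x set) \<Rightarrow> 'x \<Rightarrow> 's set set \<Rightarrow> 's set set \<Rightarrow> bool"
  for S X x where
  split:
  "\<lbrakk>R\<^sub>1 \<in> infeasible_blocks X \<R> x;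
    card (R\<^sub>1 \<inter> infeasible_scenarios X S x) \<ge> 2;
    s\<^sub>1 \<in> R\<^sub>1 \<inter> infeasible_scenarios X S x;
    s\<^sub>2 \<in> R\<^sub>1 \<inter> infeasible_scenarios X S x;
    s\<^sub>1 \<noteq> s\<^sub>2;
    s\<^sub>1 \<in> Rleft; s\<^sub>2 \<in> Rright;
    Rleft \<union> Rright = R\<^sub>1; Rleft \<inter> Rright = {}\<rbrakk>
   \<Longrightarrow> msr_step S X x \<R> ((\<R> - {R\<^sub>1}) \<union> {Rleft, Rright})"

inductive msr_loop ::
  "'s set \<Rightarrow> ('s \<Rightarrow> 'x set) \<Rightarrow> 'x \<Rightarrow> int \<Rightarrow> 's set set \<Rightarrow> 's set set \<Rightarrow> bool"
  for S X x N where
  exit: "\<not> int (card \<R>) < N \<Longrightarrow> msr_loop S X x N \<R> \<R>"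
| iterate: "\<lbrakk>int (card \<R>) < N; msr_step S X x \<R> \<R>'; msr_loop S X x N \<R>' \<R>''\<rbrakk>
   \<Longrightarrow> msr_loop S X x N \<R> \<R>''"

definition msr_returns ::
  "'s set \<Rightarrow> real \<Rightarrow> ('s \<Rightarrow> 'x set) \<Rightarrow> 's set set \<Rightarrow> 'x \<Rightarrow> 's set set \<Rightarrow> bool" where
  "msr_returns S \<tau> X \<P> x \<R> \<longleftrightarrow>
     (let \<mu> = \<lfloor>\<tau> * real (card S)\<rfloor> + 1 - int (card (infeasible_blocks X \<P> x))
      in msr_loop S X x (int (card \<P>) + \<mu>) \<P> \<R>)"

end

theory Submission
  imports Defs
begin

text \<open>
  With equal probabilities all blocks weigh \<open>1 / card S\<close>, so a point of \<open>\<X>\<close> is feasible for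
  \<open>L(\<P>)\<close> iff it violates at most \<open>k = \<lfloor>\<tau> * card S\<rfloor>\<close> blocks of \<open>\<P>\<close> (\<open>L_feasible_iff\<close>).
  Everything then follows from counting violated blocks under refinement.

  Every violated block contains a violated block of any refinement, and every satisfied block
  contains a satisfied one, because all its sub-blocks are satisfied. Blocks of \<open>\<P>\<close> are disjoint,
  so the sub-blocks chosen for different blocks differ. Hence both counts can only grow under
  refinement. Growth of the first shrinks the feasible set (\<open>L_feasible_refines\<close>); growth of the
  second says that a refinement with \<open>m\<close> more violated blocks than \<open>\<P>\<close> has at least \<open>m\<close> more blocks
  (\<open>card_infeasible_blocks_diff_le\<close>).

  If \<open>x\<close> is the unique optimum of \<open>L(\<P>)\<close>, then a refinement raises the value exactly when it cuts
  off \<open>x\<close> (\<open>L_value_less_iff_cut_off\<close>), that is, when \<open>x\<close> violates at least \<open>k + 1\<close> of its blocks.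
  By the second count this takes at least \<open>\<mu> = k + 1 - card (infeasible_blocks X \<P> x)\<close>
  additional blocks. The algorithm reaches this bound, since each split puts a violated scenario
  into both halves and so raises the number of blocks and of violated blocks by exactly one
  (\<open>msr_loop_counts\<close>).
\<close>

section \<open>Feasibility as a bound on violated blocks\<close>

lemma sum_block_weight_infeasible:
  fixes p :: "'s \<Rightarrow> real"
  assumes "finite \<A>"
  shows "(\<Sum>P\<in>\<A>. block_weight p P) - (\<Sum>P\<in>\<A>. block_weight p P * indicat_real (block_set X P) x)
       = (\<Sum>P\<in>infeasible_blocks X \<A> x. block_weight p P)"
proof -
  have "(\<Sum>P\<in>\<A>. block_weight p P) - (\<Sum>P\<in>\<A>. block_weight p P * indicat_real (block_set X P) x)
      = (\<Sum>P\<in>\<A>. if x \<notin> block_set X P then block_weight p P else 0)"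
    unfolding sum_subtractf[symmetric] by (rule sum.cong) (auto simp: indicator_def)
  also have "\<dots> = (\<Sum>P\<in>infeasible_blocks X \<A> x. block_weight p P)"
    unfolding infeasible_blocks_def using assms by (simp add: sum.inter_filter)
  finally show ?thesis .
qed

lemma block_weight_equiprobable:
  assumes "P \<subseteq> S" "P \<noteq> {}" "\<forall>s\<in>S. p s = c"
  shows "block_weight p P = c"
proof -
  have "p ` P = {c}"
    using assms by (auto simp: image_iff)
  then show ?thesis
    by (simp add: block_weight_def)
qed

lemma L_feasible_iff:
  assumes "finite S" "S \<noteq> {}" "\<forall>s\<in>S. p s = 1 / real (card S)" "partition_on S \<A>"
  shows "x \<in> L_feasible p \<tau> \<X> X \<A> \<longleftrightarrow>
         x \<in> \<X> \<and> int (card (infeasible_blocks X \<A> x)) \<le> \<lfloor>\<tau> * real (card S)\<rfloor>"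
proof -
  have pos: "real (card S) > 0"
    using assms by (simp add: card_gt_0_iff)
  have "(\<Sum>P\<in>infeasible_blocks X \<A> x. block_weight p P)
      = (\<Sum>P\<in>infeasible_blocks X \<A> x. 1 / real (card S))"
  proof (rule sum.cong)
    fix P assume "P \<in> infeasible_blocks X \<A> x"
    then have "P \<in> \<A>" by (simp add: infeasible_blocks_def)
    then have "P \<subseteq> S" "P \<noteq> {}"
      using assms(4) by (auto simp: partition_on_def)
    then show "block_weight p P = 1 / real (card S)"
      using assms(3) by (rule block_weight_equiprobable)
  qed simp
  then have "(\<Sum>P\<in>\<A>. block_weight p P) - (\<Sum>P\<in>\<A>. block_weight p P * indicat_real (block_set X P) x)
      = real (card (infeasible_blocks X \<A> x)) / real (card S)"
    using sum_block_weight_infeasible[OF finite_elements[OF assms(1,4)], of p X x] by simp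
  then have "x \<in> L_feasible p \<tau> \<X> X \<A> \<longleftrightarrow>
             x \<in> \<X> \<and> real (card (infeasible_blocks X \<A> x)) / real (card S) \<le> \<tau>"
    unfolding L_feasible_def by auto
  also have "\<dots> \<longleftrightarrow> x \<in> \<X> \<and> real (card (infeasible_blocks X \<A> x)) \<le> \<tau> * real (card S)"
    using pos by (simp add: pos_divide_le_eq)
  finally show ?thesis
    by (simp add: le_floor_iff)
qed

section \<open>Counting blocks under refinement\<close>

text \<open>
  A block of \<open>\<R>\<close> is non-empty and therefore lies in at most one block of \<open>\<P>\<close>, so choosing a
  \<open>\<psi>\<close>-block inside every \<open>\<phi>\<close>-block is injective.
\<close>

lemma refines_card_filter_mono:
  assumes "finite S" "refines S \<R> \<P>"
    and sub: "\<And>P. P \<in> \<P> \<Longrightarrow> \<phi> P \<Longrightarrow> \<exists>R\<in>\<R>. R \<subseteq> P \<and> \<psi> R"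
  shows "card {P \<in> \<P>. \<phi> P} \<le> card {R \<in> \<R>. \<psi> R}"
proof -
  have part: "partition_on S \<R>" "partition_on S \<P>"
    using assms(2) by (auto simp: refines_def)
  obtain g where g: "\<And>P. P \<in> \<P> \<Longrightarrow> \<phi> P \<Longrightarrow> g P \<in> \<R> \<and> g P \<subseteq> P \<and> \<psi> (g P)"
    using sub by metis
  have "inj_on g {P \<in> \<P>. \<phi> P}"
  proof (rule inj_onI)
    fix P Q assume P: "P \<in> {P \<in> \<P>. \<phi> P}" and Q: "Q \<in> {P \<in> \<P>. \<phi> P}" and eq: "g P = g Q"
    have "g P \<noteq> {}" "g P \<subseteq> P \<inter> Q"
      using g[of P] g[of Q] P Q eq part(1) by (auto simp: partition_on_def)
    then have "P \<inter> Q \<noteq> {}"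
      by blast
    then show "P = Q"
      using P Q part(2) by (auto simp: partition_on_def disjoint_def)
  qed
  moreover have "g ` {P \<in> \<P>. \<phi> P} \<subseteq> {R \<in> \<R>. \<psi> R}"
    using g by auto
  moreover have "finite {R \<in> \<R>. \<psi> R}"
    using finite_elements[OF assms(1) part(1)] by simp
  ultimately show ?thesis
    by (rule card_inj_on_le)
qed

lemma refines_obtain_subblock:
  assumes "refines S \<R> \<P>" "P \<in> \<P>" "s \<in> P"
  obtains R where "R \<in> \<R>" "s \<in> R" "R \<subseteq> P"
proof -
  have part: "partition_on S \<R>" "partition_on S \<P>"
    using assms(1) by (auto simp: refines_def)
  then obtain R where R: "R \<in> \<R>" "s \<in> R"
    using assms by (auto simp: partition_on_def)
  then obtain Q where Q: "Q \<in> \<P>" "R \<subseteq> Q"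
    using assms(1) by (auto simp: refines_def)
  then have "Q = P"
    using part(2) R assms by (auto simp: partition_on_def disjoint_def)
  then show thesis
    using that R Q by auto
qed

lemma card_infeasible_blocks_mono:
  assumes "finite S" "refines S \<R> \<P>"
  shows "card (infeasible_blocks X \<P> x) \<le> card (infeasible_blocks X \<R> x)"
  unfolding infeasible_blocks_def
proof (rule refines_card_filter_mono[OF assms])
  fix P assume P: "P \<in> \<P>" "x \<notin> block_set X P"
  then obtain s where s: "s \<in> P" "x \<notin> X s"
    by (auto simp: block_set_def)
  then obtain R where "R \<in> \<R>" "s \<in> R" "R \<subseteq> P"
    using refines_obtain_subblock[OF assms(2) P(1)] by metis
  then show "\<exists>R\<in>\<R>. R \<subseteq> P \<and> x \<notin> block_set X R"
    using s by (auto simp: block_set_def)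
qed

lemma card_feasible_blocks_mono:
  assumes "finite S" "refines S \<R> \<P>"
  shows "card {P \<in> \<P>. x \<in> block_set X P} \<le> card {R \<in> \<R>. x \<in> block_set X R}"
proof (rule refines_card_filter_mono[OF assms])
  fix P assume P: "P \<in> \<P>" "x \<in> block_set X P"
  then have "P \<noteq> {}"
    using assms(2) by (auto simp: refines_def partition_on_def)
  then obtain s where "s \<in> P"
    by blast
  then obtain R where "R \<in> \<R>" "R \<subseteq> P"
    using refines_obtain_subblock[OF assms(2) P(1)] by metis
  then show "\<exists>R\<in>\<R>. R \<subseteq> P \<and> x \<in> block_set X R"
    using P by (auto simp: block_set_def)
qed

lemma card_eq_infeasible_plus_feasible:
  assumes "finite \<A>"
  shows "card \<A> = card (infeasible_blocks X \<A> x) + card {A \<in> \<A>. x \<in> block_set X A}"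
proof -
  have "\<A> = infeasible_blocks X \<A> x \<union> {A \<in> \<A>. x \<in> block_set X A}"
    by (auto simp: infeasible_blocks_def)
  moreover have "infeasible_blocks X \<A> x \<inter> {A \<in> \<A>. x \<in> block_set X A} = {}"
    by (auto simp: infeasible_blocks_def)
  ultimately show ?thesis
    using assms by (metis card_Un_disjoint finite_Un)
qed

text \<open>
  This gives the lower bound on the size of a refinement: as the number of satisfied blocks cannot
  drop, new violated blocks must come on top of the blocks already there.
\<close>

lemma card_infeasible_blocks_diff_le:
  assumes "finite S" "refines S \<R> \<P>"
  shows "int (card (infeasible_blocks X \<R> x)) - int (card (infeasible_blocks X \<P> x))
       \<le> int (card \<R>) - int (card \<P>)"
proof -
  have "finite \<R>" "finite \<P>"
    using assms finite_elements by (auto simp: refines_def)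
  then show ?thesis
    using card_eq_infeasible_plus_feasible[of \<R> X x] card_eq_infeasible_plus_feasible[of \<P> X x]
      card_feasible_blocks_mono[OF assms, of x X] by linarith
qed

section \<open>Values of refined models\<close>

lemma L_feasible_refines:
  assumes "finite S" "S \<noteq> {}" "\<forall>s\<in>S. p s = 1 / real (card S)" "refines S \<R> \<P>"
  shows "L_feasible p \<tau> \<X> X \<R> \<subseteq> L_feasible p \<tau> \<X> X \<P>"
proof
  fix x assume x: "x \<in> L_feasible p \<tau> \<X> X \<R>"
  have part: "partition_on S \<R>" "partition_on S \<P>"
    using assms(4) by (auto simp: refines_def)
  show "x \<in> L_feasible p \<tau> \<X> X \<P>"
    using card_infeasible_blocks_mono[OF assms(1,4), of X x]
      L_feasible_iff[OF assms(1-3) part(1), THEN iffD1, OF x]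
    by (intro L_feasible_iff[OF assms(1-3) part(2), THEN iffD2]) linarith
qed

lemma L_value_le:
  assumes "x \<in> L_feasible p \<tau> \<X> X \<A>"
  shows "L_value p \<tau> \<X> f X \<A> \<le> ereal (f x)"
  unfolding L_value_def using assms by (rule INF_lower)

lemma L_value_eq_optimal:
  fixes f :: "'x \<Rightarrow> real"
  assumes "L_optimal p \<tau> \<X> f X \<A> x"
  shows "L_value p \<tau> \<X> f X \<A> = ereal (f x)"
proof (rule antisym)
  show "L_value p \<tau> \<X> f X \<A> \<le> ereal (f x)"
    using assms by (auto simp: L_optimal_def is_arg_min_def intro: L_value_le)
  show "ereal (f x) \<le> L_value p \<tau> \<X> f X \<A>"
    unfolding L_value_def using assms
    by (auto simp: L_optimal_def is_arg_min_linorder intro: INF_greatest)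
qed

text \<open>
  Attainment matters here: after \<open>x\<close> has been cut off, points of \<open>L(\<R>)\<close> could still approach
  the value \<open>f x\<close>, but a minimiser of \<open>L(\<R>)\<close> with this value would be a second optimum of \<open>L(\<P>)\<close>.
\<close>

lemma L_value_less_iff_cut_off:
  fixes f :: "'x \<Rightarrow> real"
  assumes sub: "L_feasible p \<tau> \<X> X \<R> \<subseteq> L_feasible p \<tau> \<X> X \<P>"
    and attained: "L_feasible p \<tau> \<X> X \<R> \<noteq> {} \<longrightarrow> (\<exists>y. L_optimal p \<tau> \<X> f X \<R> y)"
    and optimal: "L_optimal p \<tau> \<X> f X \<P> x"
    and unique: "\<forall>y. L_optimal p \<tau> \<X> f X \<P> y \<longrightarrow> y = x"
  shows "L_value p \<tau> \<X> f X \<P> < L_value p \<tau> \<X> f X \<R> \<longleftrightarrow> x \<notin> L_feasible p \<tau> \<X> X \<R>"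
proof
  assume "L_value p \<tau> \<X> f X \<P> < L_value p \<tau> \<X> f X \<R>"
  then show "x \<notin> L_feasible p \<tau> \<X> X \<R>"
    using L_value_le[of x p \<tau> \<X> X \<R> f] L_value_eq_optimal[OF optimal] by auto
next
  assume cut: "x \<notin> L_feasible p \<tau> \<X> X \<R>"
  show "L_value p \<tau> \<X> f X \<P> < L_value p \<tau> \<X> f X \<R>"
  proof (cases "L_feasible p \<tau> \<X> X \<R> = {}")
    case True
    then show ?thesis
      by (simp add: L_value_eq_optimal[OF optimal]) (simp add: L_value_def top_ereal_def)
  next
    case False
    then obtain y where y: "L_optimal p \<tau> \<X> f X \<R> y"
      using attained by auto
    then have yR: "y \<in> L_feasible p \<tau> \<X> X \<R>"
      by (simp add: L_optimal_def is_arg_min_def)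
    then have "\<not> L_optimal p \<tau> \<X> f X \<P> y"
      using unique cut by auto
    then have "f x < f y"
      using yR sub optimal unfolding L_optimal_def is_arg_min_linorder
      by (meson order.trans linorder_not_less subsetD)
    then show ?thesis
      by (simp add: L_value_eq_optimal[OF optimal] L_value_eq_optimal[OF y])
  qed
qed

section \<open>Counting blocks along the algorithm\<close>

lemma refines_split:
  assumes "refines S \<R> \<P>" "A \<union> B \<in> \<R>" "A \<inter> B = {}" "A \<noteq> {}" "B \<noteq> {}"
  shows "refines S ((\<R> - {A \<union> B}) \<union> {A, B}) \<P>"
proof -
  have part: "partition_on S \<R>" "partition_on S \<P>"
    and sub: "\<And>R. R \<in> \<R> \<Longrightarrow> \<exists>P\<in>\<P>. R \<subseteq> P"
    using assms(1) by (auto simp: refines_def)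
  have other: "R \<inter> (A \<union> B) = {}" if "R \<in> \<R> - {A \<union> B}" for R
    using that part(1) assms(2) by (auto simp: partition_on_def disjoint_def)
  have "disjoint ((\<R> - {A \<union> B}) \<union> {A, B})"
    unfolding disjoint_def
  proof (intro ballI impI)
    fix C D assume CD: "C \<in> (\<R> - {A \<union> B}) \<union> {A, B}" "D \<in> (\<R> - {A \<union> B}) \<union> {A, B}" "C \<noteq> D"
    show "C \<inter> D = {}"
    proof (cases "C \<in> \<R> - {A \<union> B} \<and> D \<in> \<R> - {A \<union> B}")
      case True
      then show ?thesis
        using part(1) CD(3) by (auto simp: partition_on_def disjoint_def)
    next
      case False
      then show ?thesis
        using CD other[of C] other[of D] assms(3) by blast
    qed
  qed
  moreover have "\<Union>((\<R> - {A \<union> B}) \<union> {A, B}) = \<Union>\<R>"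
    using assms(2) by auto
  ultimately have "partition_on S ((\<R> - {A \<union> B}) \<union> {A, B})"
    using part(1) assms(4,5) by (auto simp: partition_on_def)
  moreover have "\<exists>P\<in>\<P>. R \<subseteq> P" if "R \<in> (\<R> - {A \<union> B}) \<union> {A, B}" for R
    using that sub sub[OF assms(2)] by blast
  ultimately show ?thesis
    using part(2) by (auto simp: refines_def)
qed

lemma card_split:
  assumes "finite \<A>" "A \<union> B \<in> \<A>" "A \<notin> \<A>" "B \<notin> \<A>" "A \<noteq> B"
  shows "card ((\<A> - {A \<union> B}) \<union> {A, B}) = Suc (card \<A>)"
proof -
  have "card ((\<A> - {A \<union> B}) \<union> {A, B}) = card (\<A> - {A \<union> B}) + card {A, B}"
    using assms by (intro card_Un_disjoint) auto
  moreover have "card \<A> = Suc (card (\<A> - {A \<union> B}))"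
    using card.remove[OF assms(1,2)] .
  ultimately show ?thesis
    using assms(5) by simp
qed

text \<open>
  The two scenarios \<open>s\<^sub>1\<close> and \<open>s\<^sub>2\<close> witness that both halves of the split block are violated, so
  one violated block is replaced by two.
\<close>

lemma msr_step_counts:
  assumes "msr_step S X x \<R> \<R>'" "finite S" "refines S \<R> \<P>"
  shows "refines S \<R>' \<P>"
    and "card \<R>' = Suc (card \<R>)"
    and "card (infeasible_blocks X \<R>' x) = Suc (card (infeasible_blocks X \<R> x))"
proof -
  from assms(1) obtain s\<^sub>1 s\<^sub>2 A B where
    \<R>': "\<R>' = (\<R> - {A \<union> B}) \<union> {A, B}"
    and AB: "A \<union> B \<in> infeasible_blocks X \<R> x" "A \<inter> B = {}"
    and s: "s\<^sub>1 \<in> A" "s\<^sub>2 \<in> B" "x \<notin> X s\<^sub>1" "x \<notin> X s\<^sub>2"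
    by cases (auto simp: infeasible_scenarios_def)
  have in\<R>: "A \<union> B \<in> \<R>"
    using AB(1) by (simp add: infeasible_blocks_def)
  have disj: "disjoint \<R>" and fin: "finite \<R>"
    using assms(2,3) finite_elements by (auto simp: refines_def partition_on_def)
  have viol: "x \<notin> block_set X A" "x \<notin> block_set X B"
    using s by (auto simp: block_set_def)
  \<comment> \<open>A half that were already a block would meet the different block \<open>A \<union> B\<close>.\<close>
  have "A \<union> B \<noteq> A" "A \<union> B \<noteq> B"
    using s AB(2) by auto
  then have "A \<notin> \<R>" "B \<notin> \<R>"
    using disjointD[OF disj in\<R>, of A] disjointD[OF disj in\<R>, of B] s(1,2) by auto
  moreover have "A \<noteq> B"
    using s(1,2) AB(2) by auto
  ultimately have new: "A \<notin> \<R>" "B \<notin> \<R>" "A \<noteq> B" .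
  show "refines S \<R>' \<P>"
    unfolding \<R>' using s by (intro refines_split[OF assms(3) in\<R> AB(2)]) auto
  show "card \<R>' = Suc (card \<R>)"
    unfolding \<R>' by (rule card_split[OF fin in\<R> new])
  have "infeasible_blocks X \<R>' x = (infeasible_blocks X \<R> x - {A \<union> B}) \<union> {A, B}"
    unfolding \<R>' infeasible_blocks_def using viol by auto
  also have "card \<dots> = Suc (card (infeasible_blocks X \<R> x))"
    using AB(1) new fin by (intro card_split) (auto simp: infeasible_blocks_def)
  finally show "card (infeasible_blocks X \<R>' x) = Suc (card (infeasible_blocks X \<R> x))" .
qed

text \<open>
  The loop stops at size exactly \<open>N\<close>, because the size grows in steps of one; the hypothesis
  \<open>int (card \<R>) \<le> N\<close> rules out starting above \<open>N\<close>.
\<close>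

lemma msr_loop_counts:
  assumes "msr_loop S X x N \<R> \<R>'" "finite S" "refines S \<R> \<P>" "int (card \<R>) \<le> N"
  shows "refines S \<R>' \<P>" (is ?refines)
    and "int (card \<R>') = N" (is ?size)
    and "int (card (infeasible_blocks X \<R>' x))
       = int (card (infeasible_blocks X \<R> x)) + (N - int (card \<R>))" (is ?viol)
proof -
  from assms have "?refines \<and> ?size \<and> ?viol"
  proof (induction rule: msr_loop.induct)
    case (exit \<R>)
    then show ?case by simp
  next
    case (iterate \<R> \<R>\<^sub>1 \<R>\<^sub>2)
    have "refines S \<R>\<^sub>1 \<P>" "card \<R>\<^sub>1 = Suc (card \<R>)"
      "card (infeasible_blocks X \<R>\<^sub>1 x) = Suc (card (infeasible_blocks X \<R> x))"
      using msr_step_counts[OF iterate.hyps(2) iterate.prems(1,2)] by auto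
    then show ?case
      using iterate.IH iterate.hyps(1) iterate.prems(1) by auto
  qed
  then show ?refines ?size ?viol by auto
qed

section \<open>Minimality of the refinement\<close>

theorem theorem1:
  fixes S :: "'s set" and p :: "'s \<Rightarrow> real" and \<tau> :: real
    and \<X> :: "(real ^ 'n) set" and f :: "real ^ 'n \<Rightarrow> real"
    and X :: "'s \<Rightarrow> (real ^ 'n) set"
    and \<P> \<R> :: "'s set set" and x :: "real ^ 'n"
  assumes "finite S" and "S \<noteq> {}"
    and "0 \<le> \<tau>" and "\<tau> \<le> 1"
    and equiprobable: "\<forall>s\<in>S. p s = 1 / real (card S)"
    and attained: "\<forall>\<Q>. partition_on S \<Q> \<and> L_feasible p \<tau> \<X> X \<Q> \<noteq> {}
                      \<longrightarrow> (\<exists>y. L_optimal p \<tau> \<X> f X \<Q> y)"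
    and "partition_on S \<P>"
    and optimal: "L_optimal p \<tau> \<X> f X \<P> x"
    and unique: "\<forall>y. L_optimal p \<tau> \<X> f X \<P> y \<longrightarrow> y = x"
    and infeasible: "x \<notin> original_feasible S p \<tau> \<X> X"
    and returned: "msr_returns S \<tau> X \<P> x \<R>"
  shows "refines S \<R> \<P>
    \<and> L_value p \<tau> \<X> f X \<R> > L_value p \<tau> \<X> f X \<P>
    \<and> (\<forall>\<R>'. refines S \<R>' \<P> \<and> L_value p \<tau> \<X> f X \<R>' > L_value p \<tau> \<X> f X \<P>
          \<longrightarrow> card \<R>' \<ge> card \<R>)"
proof -
  let ?k = "\<lfloor>\<tau> * real (card S)\<rfloor>"
  let ?N = "int (card \<P>) + (?k + 1 - int (card (infeasible_blocks X \<P> x)))"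
  have refl: "refines S \<P> \<P>"
    using \<open>partition_on S \<P>\<close> by (auto simp: refines_def)
  have x: "x \<in> L_feasible p \<tau> \<X> X \<P>"
    using optimal by (simp add: L_optimal_def is_arg_min_def)
  note feasible_iff = L_feasible_iff[OF \<open>finite S\<close> \<open>S \<noteq> {}\<close> equiprobable]
  have x_feasible: "x \<in> \<X>" "int (card (infeasible_blocks X \<P> x)) \<le> ?k"
    using feasible_iff[OF \<open>partition_on S \<P>\<close>, THEN iffD1, OF x] by auto

  have raises_iff: "L_value p \<tau> \<X> f X \<P> < L_value p \<tau> \<X> f X \<Q>
      \<longleftrightarrow> ?k + 1 \<le> int (card (infeasible_blocks X \<Q> x))" if "refines S \<Q> \<P>" for \<Q>
  proof -
    have "partition_on S \<Q>"
      using that by (simp add: refines_def)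
    then have "L_feasible p \<tau> \<X> X \<Q> \<noteq> {} \<longrightarrow> (\<exists>y. L_optimal p \<tau> \<X> f X \<Q> y)"
      using attained by simp
    then have "L_value p \<tau> \<X> f X \<P> < L_value p \<tau> \<X> f X \<Q> \<longleftrightarrow> x \<notin> L_feasible p \<tau> \<X> X \<Q>"
      by (rule L_value_less_iff_cut_off
            [OF L_feasible_refines[OF \<open>finite S\<close> \<open>S \<noteq> {}\<close> equiprobable that] _ optimal unique])
    then show ?thesis
      using feasible_iff[OF \<open>partition_on S \<Q>\<close>, of x \<tau> \<X> X] x_feasible(1) by auto
  qed

  have loop: "msr_loop S X x ?N \<P> \<R>"
    using returned by (simp add: msr_returns_def Let_def)
  have "int (card \<P>) \<le> ?N"
    using x_feasible(2) by simp
  note counts = msr_loop_counts[OF loop \<open>finite S\<close> refl this]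
  have "L_value p \<tau> \<X> f X \<P> < L_value p \<tau> \<X> f X \<R>"
    using raises_iff[OF counts(1)] counts(3) by simp
  moreover have "card \<R> \<le> card \<R>'"
    if "refines S \<R>' \<P>" "L_value p \<tau> \<X> f X \<P> < L_value p \<tau> \<X> f X \<R>'" for \<R>'
    using card_infeasible_blocks_diff_le[OF \<open>finite S\<close> that(1), of X x]
      raises_iff[OF that(1)] that(2) counts(2) by simp
  ultimately show ?thesis
    using counts(1) by blast
qed

end
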